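(* Let $\{X_k\}_{k\in\mathbb N_0}$ be a family of Borel spaces and let $\Omega_n=\prod_{k=0}^nX_k$ be the product spaces for any $n\in\bar{\mathbb N}_0$. Let further $P^0,\tilde P^0\in\mathcal P(X_0)$ and, for $k\in\mathbb N$, let $P^k,\tilde P^k:\Omega_{k-1}\to\mathcal P(X_k)$ be stochastic kernels. Let $\mathsf P^n:=\bigotimes_{k=0}^nP^k$ and $\tilde{\mathsf P}^n:=\bigotimes_{k=0}^n\tilde P^k$ be the corresponding product probability measures on $\Omega_n$, $n\in\mathbb N_0$. If a sequence of reals $(c_k)_{k\in\mathbb N_0}$ is such that $\|P^k-\tilde P^k\|\le c_k$ for all $k\in\mathbb N_0$, then for any $n\in\mathbb N_0$ it holds that $$\|\mathsf P^n-\tilde{\mathsf P}^n\|\le 2-2\prod_{k=0}^n\left(1-\tfrac12c_k\right).$$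
   Context: $\mathbb N=\{1,2,\dots\}$, $\mathbb N_0=\mathbb N\cup\{0\}$ and $\bar{\mathbb N}_0=\mathbb N_0\cup\{\infty\}$. A (standard) Borel space is a topological space homeomorphic to a Borel subset of a complete separable metric space; it is always endowed with its Borel $\sigma$-algebra $\mathfrak B(X)$, and products carry the product $\sigma$-algebra. $\mathcal P(X)$ is the set of probability measures on $(X,\mathfrak B(X))$. A stochastic kernel $K:X\to\mathcal P(Y)$, $x\mapsto K_x$, is a map such that $x\mapsto K_x(A)$ is measurable for every $A\in\mathfrak B(Y)$. Product of a measure and a kernel: for $\mu\in\mathcal P(X)$ and a stochastic kernel $K:X\to\mathcal P(Y)$, $\mu\otimes K$ is the unique probability measure on $X\times Y$ with $(\mu\otimes K)(A\times B)=\int_AK_x(B)\,\mu(dx)$ for all measurable $A\subseteq X$, $B\subseteq Y$. Inductively, $\bigotimes_{k=0}^0P^k=P^0$ and $\bigotimes_{k=0}^{n+1}P^k=\left(\bigotimes_{k=0}^nP^k\right)\otimes P^{n+1}$. Total variation: for a finite signed measure $\nu$ on $X$ with Hahn-Jordan decomposition $\nu=\nu^+-\nu^-$, $\|\nu\|=\nu^+(X)+\nu^-(X)$ (so $\|\nu-\tilde\nu\|=2\sup_A|\nu(A)-\tilde\nu(A)|$ for probability measures $\nu,\tilde\nu$); for a kernel $K$ from $X$ to finite signed measures, $\|K\|=\sup_{x\in X}\|K_x\|$.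
   Formalization: The formal theorem additionally assumes c_k ≤ 2 for all k ≤ n; without an upper bound the inequality is false (e.g. P^0, P̃^0 distinct point masses, equal later kernels, c_k = 4, n = 1 gives 2 ≤ 0). *)

theory Defs
  imports "HOL-Probability.Probability"
begin

section \<open>Borel spaces\<close>

definition borel_of :: "'a topology \<Rightarrow> 'a measure" where
  "borel_of X = sigma (topspace X) {U. openin X U}"

text \<open>
  A definition cannot quantify over the type carrying the ambient complete separable metric
  space, so its points are taken to be reals. As complete separable metric spaces
  have at most the cardinality of the continuum, this is no restriction; lemma \<open>borel_spaceI\<close>
  below shows that an ambient space on an arbitrary type will do.
\<close>

definition borel_space :: "'a topology \<Rightarrow> bool" where
  "borel_space X \<longleftrightarrow>
     (\<exists>(Y :: real topology) S. completely_metrizable_space Y \<and> separable_space Y \<and>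
        S \<in> sets (borel_of Y) \<and> X homeomorphic_space subtopology Y S)"

lemma space_borel_of [simp]: "space (borel_of X) = topspace X"
  unfolding borel_of_def by (rule space_measure_of) (auto dest: openin_subset)

lemma sets_borel_of: "sets (borel_of X) = sigma_sets (topspace X) {U. openin X U}"
  unfolding borel_of_def by (rule sets_measure_of) (auto dest: openin_subset)

lemma borel_of_measurable_continuous:
  assumes "continuous_map X Y f"
  shows "f \<in> borel_of X \<rightarrow>\<^sub>M borel_of Y"
  unfolding borel_of_def[of Y]
proof (rule measurable_measure_of)
  show "{U. openin Y U} \<subseteq> Pow (topspace Y)" by (auto dest: openin_subset)
  show "f \<in> space (borel_of X) \<rightarrow> topspace Y"
    using assms by (simp add: continuous_map_def)
  fix U assume "U \<in> {U. openin Y U}"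
  then have "openin X {x \<in> topspace X. f x \<in> U}"
    using assms by (simp add: continuous_map_def)
  moreover have "f -` U \<inter> space (borel_of X) = {x \<in> topspace X. f x \<in> U}" by auto
  ultimately show "f -` U \<inter> space (borel_of X) \<in> sets (borel_of X)"
    by (simp add: sets_borel_of sigma_sets.Basic)
qed

lemma separable_metric_lepoll_reals:
  assumes "separable_space (mtopology_of (m :: 'b metric))"
  shows "mspace m \<lesssim> (UNIV :: real set)"
proof -
  interpret Metric_space "mspace m" "mdist m" by (rule Metric_space_mspace_mdist)
  obtain C where C: "countable C" "C \<subseteq> mspace m" "mtopology closure_of C = mspace m"
    using assms by (auto simp: separable_space_def mtopology_of_def)
  define F where "F x = {(c, n :: nat). c \<in> C \<and> mdist m x c < 1 / Suc n}" for x
  have "inj_on F (mspace m)"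
  proof (rule inj_onI, rule ccontr)
    fix x y assume xy: "x \<in> mspace m" "y \<in> mspace m" "F x = F y" "x \<noteq> y"
    then have "mdist m x y > 0" by (simp add: mdist_pos_eq)
    then obtain n :: nat where n: "1 / Suc n < mdist m x y / 2"
      using nat_approx_posE[of "mdist m x y / 2"] by (metis half_gt_zero)
    have "x \<in> mtopology closure_of C" using C xy by simp
    then have "\<exists>c\<in>C. c \<in> mball x (1 / Suc n)"
      by (simp add: metric_closure_of)
    then obtain c where c: "c \<in> C" "mdist m x c < 1 / Suc n" by auto
    then have "(c, n) \<in> F y" using xy by (auto simp: F_def)
    then have "mdist m y c < 1 / Suc n" by (simp add: F_def)
    moreover have "mdist m x y \<le> mdist m x c + mdist m c y"
      using triangle c C xy by blast
    ultimately show False using c n commute by (smt (verit) field_sum_of_halves)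
  qed
  then have "mspace m \<lesssim> Pow (C \<times> (UNIV :: nat set))"
    unfolding lepoll_def by (intro exI[of _ F]) (auto simp: F_def)
  also have "\<dots> \<lesssim> (UNIV :: nat set set)"
  proof -
    have "countable (C \<times> (UNIV :: nat set))" using C by simp
    then obtain g :: "_ \<Rightarrow> nat" where "inj_on g (C \<times> (UNIV :: nat set))" by (rule countableE)
    then show ?thesis unfolding lepoll_def
      by (intro exI[of _ "\<lambda>S. g ` S"]) (simp add: inj_on_image_Pow)
  qed
  also have "\<dots> \<lesssim> (UNIV :: real set)"
    using nat_sets_eqpoll_reals eqpoll_imp_lepoll by blast
  finally show ?thesis .
qed

lemma borel_spaceI:
  fixes Y :: "'b topology"
  assumes Y: "completely_metrizable_space Y" "separable_space Y"
    and S: "S \<in> sets (borel_of Y)" and X: "X homeomorphic_space subtopology Y S"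
  shows "borel_space X"
proof -
  obtain M d where Md: "Metric_space M d" "Y = Metric_space.mtopology M d"
    using Y(1) by (auto simp: completely_metrizable_space_def)
  have Ym: "mtopology_of (metric (M, d)) = Y" "mspace (metric (M, d)) = M"
    using Md by (simp_all add: Metric_space.mtopology_of Metric_space.mspace_metric)
  have tY: "topspace Y = M"
    using Md by (simp add: Metric_space.topspace_mtopology)
  obtain e :: "'b \<Rightarrow> real" where e: "inj_on e (topspace Y)"
    using separable_metric_lepoll_reals[of "metric (M, d)"] Y(2) Ym tY
    by (auto simp: lepoll_def)
  define g where "g = inv_into (topspace Y) e"
  define Z where "Z = pullback_topology (e ` topspace Y) g Y"
  have g: "g (e y) = y" if "y \<in> topspace Y" for y
    using e that by (simp add: g_def)
  have tZ: "topspace Z = e ` topspace Y"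
    using g by (auto simp: Z_def topspace_pullback_topology)
  have cg: "continuous_map Z Y g"
    unfolding Z_def using continuous_map_pullback[of Y Y id] by simp
  have ce: "continuous_map Y Z e"
    unfolding Z_def
  proof (rule continuous_map_pullback')
    show "continuous_map Y Y (g \<circ> e)"
      by (rule continuous_map_eq[OF continuous_map_id]) (simp add: g)
    show "topspace Y \<subseteq> e -` (e ` topspace Y)" by auto
  qed
  have hom: "homeomorphic_maps Y Z e g"
    using cg ce g tZ by (auto simp: homeomorphic_maps_def)
  then have YZ: "Y homeomorphic_space Z" by (auto simp: homeomorphic_space_def)
  have SY: "S \<subseteq> topspace Y" using sets.sets_into_space[OF S] by simp
  have "g -` S \<inter> space (borel_of Z) \<in> sets (borel_of Z)"
    using borel_of_measurable_continuous[OF cg] S by (rule measurable_sets)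
  moreover have "g -` S \<inter> space (borel_of Z) = e ` S"
    using SY g tZ by force
  ultimately have eS: "e ` S \<in> sets (borel_of Z)" by simp
  have "homeomorphic_maps (subtopology Y S) (subtopology Z (e ` S)) e g"
    using hom by (rule homeomorphic_maps_subtopologies) (use SY tZ in auto)
  then have "X homeomorphic_space subtopology Z (e ` S)"
    using X homeomorphic_space_trans homeomorphic_maps_imp_homeomorphic_space by metis
  moreover have "completely_metrizable_space Z" "separable_space Z"
    using Y homeomorphic_completely_metrizable_space[OF YZ] homeomorphic_separable_space[OF YZ]
    by simp_all
  ultimately show ?thesis
    using eS unfolding borel_space_def by (intro exI[of _ Z] exI[of _ "e ` S"] conjI)
qed

section \<open>Measures on products\<close>

text \<open>
  \<open>kernel_prod M N K\<close> is the product of the probability measure \<open>M\<close> and the kernel \<open>K\<close>, whose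
  values are measures on the \<open>\<sigma>\<close>-algebra of \<open>N\<close>. A stochastic kernel from \<open>M\<close> to \<open>N\<close> is an
  element of \<open>M \<rightarrow>\<^sub>M prob_algebra N\<close>.
\<close>

definition kernel_prod :: "'a measure \<Rightarrow> 'b measure \<Rightarrow> ('a \<Rightarrow> 'b measure) \<Rightarrow> ('a \<times> 'b) measure" where
  "kernel_prod M N K =
     (THE R. prob_space R \<and> sets R = sets (M \<Otimes>\<^sub>M N) \<and>
        (\<forall>A\<in>sets M. \<forall>B\<in>sets N. measure R (A \<times> B) = (LINT x:A|M. measure (K x) B)))"

lemma kernel_prod_ex1:
  assumes M: "prob_space M" and K: "K \<in> M \<rightarrow>\<^sub>M prob_algebra N"
  shows "\<exists>!R. prob_space R \<and> sets R = sets (M \<Otimes>\<^sub>M N) \<and>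
    (\<forall>A\<in>sets M. \<forall>B\<in>sets N. measure R (A \<times> B) = (LINT x:A|M. measure (K x) B))"
proof (rule ex_ex1I)
  interpret M: prob_space M by fact
  have M': "M \<in> space (prob_algebra M)" using M by (simp add: space_prob_algebra)
  let ?f = "\<lambda>x. distr (K x) (M \<Otimes>\<^sub>M N) (Pair x)"
  have f: "?f \<in> M \<rightarrow>\<^sub>M prob_algebra (M \<Otimes>\<^sub>M N)"
    by (rule measurable_distr_prob_space2[OF K]) simp
  have Kx: "prob_space (K x)" "sets (K x) = sets N" if "x \<in> space M" for x
    using measurable_space[OF K that] by (auto simp: space_prob_algebra)
  show "\<exists>R. prob_space R \<and> sets R = sets (M \<Otimes>\<^sub>M N) \<and>
    (\<forall>A\<in>sets M. \<forall>B\<in>sets N. measure R (A \<times> B) = (LINT x:A|M. measure (K x) B))"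
  proof (intro exI[of _ "M \<bind> ?f"] conjI ballI)
    show "prob_space (M \<bind> ?f)" by (rule prob_space_bind'[OF M' f])
    show "sets (M \<bind> ?f) = sets (M \<Otimes>\<^sub>M N)" by (rule sets_bind'[OF M' f])
    fix A B assume AB: "A \<in> sets M" "B \<in> sets N"
    have "measure (M \<bind> ?f) (A \<times> B) = (LINT x|M. measure (?f x) (A \<times> B))"
      using AB by (intro M.measure_bind[OF measurable_prob_algebraD[OF f]]) auto
    also have "\<dots> = (LINT x:A|M. measure (K x) B)"
      unfolding set_lebesgue_integral_def
    proof (rule Bochner_Integration.integral_cong[OF refl])
      fix x assume x: "x \<in> space M"
      have "Pair x \<in> K x \<rightarrow>\<^sub>M M \<Otimes>\<^sub>M N"
        using x Kx[OF x] by (simp cong: measurable_cong_sets)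
      moreover have "Pair x -` (A \<times> B) \<inter> space (K x) = (if x \<in> A then B else {})"
        using sets.sets_into_space[OF AB(2)] sets_eq_imp_space_eq[OF Kx(2)[OF x]] by auto
      ultimately show "measure (?f x) (A \<times> B) = indicator A x *\<^sub>R measure (K x) B"
        using AB by (simp add: measure_distr)
    qed
    finally show "measure (M \<bind> ?f) (A \<times> B) = (LINT x:A|M. measure (K x) B)" .
  qed
next
  fix R R'
  assume R: "prob_space R \<and> sets R = sets (M \<Otimes>\<^sub>M N) \<and>
      (\<forall>A\<in>sets M. \<forall>B\<in>sets N. measure R (A \<times> B) = (LINT x:A|M. measure (K x) B))"
    and R': "prob_space R' \<and> sets R' = sets (M \<Otimes>\<^sub>M N) \<and>
      (\<forall>A\<in>sets M. \<forall>B\<in>sets N. measure R' (A \<times> B) = (LINT x:A|M. measure (K x) B))"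
  interpret R: prob_space R using R by simp
  interpret R': prob_space R' using R' by simp
  show "R = R'"
  proof (rule measure_eqI_generator_eq[OF Int_stable_pair_measure_generator,
        of M N "space M \<times> space N" R R' "\<lambda>_::nat. space M \<times> space N"])
    show "{a \<times> b |a b. a \<in> sets M \<and> b \<in> sets N} \<subseteq> Pow (space M \<times> space N)"
      by (rule pair_measure_closed)
    show "sets R = sigma_sets (space M \<times> space N) {a \<times> b |a b. a \<in> sets M \<and> b \<in> sets N}"
      "sets R' = sigma_sets (space M \<times> space N) {a \<times> b |a b. a \<in> sets M \<and> b \<in> sets N}"
      using R R' by (simp_all add: sets_pair_measure)
    show "range (\<lambda>_. space M \<times> space N) \<subseteq> {a \<times> b |a b. a \<in> sets M \<and> b \<in> sets N}"
      by auto
    show "emeasure R Z = emeasure R' Z" if "Z \<in> {a \<times> b |a b. a \<in> sets M \<and> b \<in> sets N}" for Z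
      using that R R' by (auto simp: R.emeasure_eq_measure R'.emeasure_eq_measure)
    show "(\<Union>i::nat. space M \<times> space N) = space M \<times> space N" by simp
    show "emeasure R (space M \<times> space N) \<noteq> \<infinity>" by simp
  qed
qed

text \<open>
  The spaces \<open>X k\<close> are topologies on subsets of one type \<open>'a\<close>, which for a family on unrelated
  sets is their disjoint union.
\<close>

definition Omega :: "(nat \<Rightarrow> 'a topology) \<Rightarrow> nat \<Rightarrow> (nat \<Rightarrow> 'a) measure" where
  "Omega X n = (\<Pi>\<^sub>M k\<in>{..n}. borel_of (X k))"

text \<open>
  The points of \<open>Omega X n\<close> are functions that are \<open>undefined\<close> outside \<open>{..n}\<close>, so
  \<open>X 0\<close> is identified with \<open>Omega X 0\<close>, and \<open>Omega X n \<times> X (n + 1)\<close> with \<open>Omega X (n + 1)\<close>,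
  by pushing measures forward along the canonical bijections. The initial law is \<open>P0\<close>; the
  kernels are \<open>P k\<close> for \<open>k \<ge> 1\<close>, and \<open>P 0\<close> is not used.
\<close>

primrec prod_measure ::
  "(nat \<Rightarrow> 'a topology) \<Rightarrow> 'a measure \<Rightarrow> (nat \<Rightarrow> (nat \<Rightarrow> 'a) \<Rightarrow> 'a measure) \<Rightarrow> nat \<Rightarrow> (nat \<Rightarrow> 'a) measure"
where
  "prod_measure X P0 P 0 = distr P0 (Omega X 0) (\<lambda>x. \<lambda>i\<in>{..0}. x)"
| "prod_measure X P0 P (Suc n) =
     distr (kernel_prod (prod_measure X P0 P n) (borel_of (X (Suc n))) (P (Suc n)))
       (Omega X (Suc n)) (\<lambda>(\<omega>, x). fun_upd \<omega> (Suc n) x)"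

section \<open>Total variation\<close>

text \<open>
  A finite signed measure is represented by its set function \<open>\<nu>\<close>, on the \<open>\<sigma>\<close>-algebra of \<open>M\<close>.
\<close>

definition hahn_set :: "'a measure \<Rightarrow> ('a set \<Rightarrow> real) \<Rightarrow> 'a set \<Rightarrow> bool" where
  "hahn_set M \<nu> S \<longleftrightarrow> S \<in> sets M \<and> (\<forall>A\<in>sets M. A \<subseteq> S \<longrightarrow> 0 \<le> \<nu> A) \<and>
     (\<forall>A\<in>sets M. A \<inter> S = {} \<longrightarrow> \<nu> A \<le> 0)"

definition pos_part :: "'a measure \<Rightarrow> ('a set \<Rightarrow> real) \<Rightarrow> 'a set \<Rightarrow> real" where
  "pos_part M \<nu> A = \<nu> (A \<inter> (SOME S. hahn_set M \<nu> S))"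

definition neg_part :: "'a measure \<Rightarrow> ('a set \<Rightarrow> real) \<Rightarrow> 'a set \<Rightarrow> real" where
  "neg_part M \<nu> A = - \<nu> (A - (SOME S. hahn_set M \<nu> S))"

definition tv_norm :: "'a measure \<Rightarrow> ('a set \<Rightarrow> real) \<Rightarrow> real" where
  "tv_norm M \<nu> = pos_part M \<nu> (space M) + neg_part M \<nu> (space M)"

text \<open>The norm of a kernel from \<open>M\<close> to finite signed measures on \<open>N\<close>; it may be infinite.\<close>

definition kernel_norm :: "'a measure \<Rightarrow> 'b measure \<Rightarrow> ('a \<Rightarrow> 'b set \<Rightarrow> real) \<Rightarrow> ereal" where
  "kernel_norm M N K = (SUP x\<in>space M. ereal (tv_norm N (K x)))"

definition signed_diff :: "'a measure \<Rightarrow> 'a measure \<Rightarrow> 'a set \<Rightarrow> real" where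
  "signed_diff \<mu> \<mu>' A = measure \<mu> A - measure \<mu>' A"

lemma tv_norm_diff_prob:
  assumes "prob_space \<mu>" "prob_space \<mu>'" and sets: "sets \<mu> = sets M" "sets \<mu>' = sets M"
  shows "tv_norm M (signed_diff \<mu> \<mu>') = 2 * (SUP A\<in>sets M. \<bar>measure \<mu> A - measure \<mu>' A\<bar>)"
proof -
  interpret \<mu>: prob_space \<mu> by fact
  interpret \<mu>': prob_space \<mu>' by fact
  let ?d = "signed_diff \<mu> \<mu>'"
  have sp: "space \<mu> = space M" "space \<mu>' = space M"
    using sets by (auto dest: sets_eq_imp_space_eq)
  have "\<exists>S. hahn_set M ?d S"
    using finite_unsigned_Hahn_decomposition[OF \<mu>.finite_measure_axioms
      \<mu>'.finite_measure_axioms] sets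
    by (simp add: hahn_set_def signed_diff_def \<mu>.emeasure_eq_measure
        \<mu>'.emeasure_eq_measure Bex_def)
  then have S': "hahn_set M ?d (SOME S. hahn_set M ?d S)" by (rule someI_ex)
  define S where "S = (SOME S. hahn_set M ?d S)"
  have S: "hahn_set M ?d S" using S' unfolding S_def .
  have SM: "S \<in> sets M" using S unfolding hahn_set_def by blast
  then have SI: "space M \<inter> S = S" by (rule sets.Int_space_eq1)
  have d_compl: "?d (space M - A) = - ?d A" if "A \<in> sets M" for A
    using that sets \<mu>.prob_compl[of A] \<mu>'.prob_compl[of A] sp by (simp add: signed_diff_def)
  have tv: "tv_norm M ?d = 2 * ?d S"
    unfolding tv_norm_def pos_part_def neg_part_def S_def[symmetric] SI d_compl[OF SM] by simp
  have le: "?d A \<le> ?d S" if A: "A \<in> sets M" for A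
  proof -
    have d_split: "?d B = ?d (B \<inter> C) + ?d (B - C)" if BC: "B \<in> sets M" "C \<in> sets M" for B C
    proof -
      have "measure \<mu> (B \<inter> C \<union> (B - C)) = measure \<mu> (B \<inter> C) + measure \<mu> (B - C)"
        by (rule \<mu>.finite_measure_Union) (use BC sets in auto)
      moreover have "measure \<mu>' (B \<inter> C \<union> (B - C)) = measure \<mu>' (B \<inter> C) + measure \<mu>' (B - C)"
        by (rule \<mu>'.finite_measure_Union) (use BC sets in auto)
      ultimately show ?thesis by (simp add: signed_diff_def Int_Diff_Un)
    qed
    have AS: "A - S \<in> sets M" "S - A \<in> sets M" using A SM by auto
    have "?d (A - S) \<le> 0" using S AS(1) Diff_disjoint[of S A] unfolding hahn_set_def
      by (simp add: Int_commute)
    moreover have "?d (S - A) \<ge> 0" using S AS(2) Diff_subset[of S A] unfolding hahn_set_def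
      by simp
    ultimately show ?thesis using d_split[OF A SM] d_split[OF SM A] by (simp add: Int_commute)
  qed
  have "(SUP A\<in>sets M. \<bar>?d A\<bar>) = ?d S"
  proof (rule cSup_eq_maximum)
    have "0 \<le> ?d S" using le[of "{}"] by (simp add: signed_diff_def)
    then show "?d S \<in> (\<lambda>A. \<bar>?d A\<bar>) ` sets M" using SM by (metis abs_of_nonneg imageI)
    fix y assume "y \<in> (\<lambda>A. \<bar>?d A\<bar>) ` sets M"
    then obtain A where A: "A \<in> sets M" "y = \<bar>?d A\<bar>" by auto
    have "?d (space M - A) \<le> ?d S" by (rule le) (use A in auto)
    then show "y \<le> ?d S" using A le[OF A(1)] d_compl[OF A(1)] by simp
  qed
  then show ?thesis using tv by (simp add: signed_diff_def)
qed

end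

theory Submission
  imports Defs
begin

text \<open>
  With \<open>f x = K x (C\<^sub>x)\<close> and \<open>g x = K' x (C\<^sub>x)\<close> for the sections \<open>C\<^sub>x\<close> of a set \<open>C\<close>, the two product
  measures of \<open>C\<close> are \<open>\<integral>f dM\<close> and \<open>\<integral>g dM'\<close>. If the kernels differ by at most \<open>e\<close> on every set,
  then \<open>g\<close> dominates \<open>h = max 0 (f - e)\<close>, which takes values in \<open>[0, 1 - e]\<close>, so that
  \<open>\<integral>f dM - \<integral>g dM' \<le> \<integral>(f - h) dM + (\<integral>h dM - \<integral>h dM') \<le> e + (1 - e) d = 1 - (1 - e) (1 - d)\<close>
  where \<open>d\<close> bounds \<open>M - M'\<close> on every set. Induction on \<open>n\<close> yields the product.
\<close>

section \<open>Total variation as a bound on events\<close>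

text \<open>A one-sided bound is enough because passing to the complement flips the sign of a
  difference of probabilities. The factor 2 is why the rest of the proof works with
  \<open>c k / 2\<close>.\<close>

lemma tv_norm_le_iff:
  assumes "prob_space \<mu>" "prob_space \<mu>'" and sets: "sets \<mu> = sets M" "sets \<mu>' = sets M"
  shows "tv_norm M (signed_diff \<mu> \<mu>') \<le> 2 * b \<longleftrightarrow> (\<forall>A\<in>sets M. measure \<mu> A - measure \<mu>' A \<le> b)"
    (is "_ \<longleftrightarrow> ?R")
proof -
  interpret \<mu>: prob_space \<mu> by fact
  interpret \<mu>': prob_space \<mu>' by fact
  let ?D = "\<lambda>A. \<bar>measure \<mu> A - measure \<mu>' A\<bar>"
  have sp: "space \<mu> = space M" "space \<mu>' = space M"
    using sets by (auto dest: sets_eq_imp_space_eq)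
  have bdd: "bdd_above (?D ` sets M)"
  proof (rule bdd_aboveI2)
    show "?D A \<le> 1" for A
      using \<mu>.prob_le_1[of A] \<mu>'.prob_le_1[of A] measure_nonneg[of \<mu> A] measure_nonneg[of \<mu>' A]
      by linarith
  qed
  have "(SUP A\<in>sets M. ?D A) \<le> b \<longleftrightarrow> ?R"
  proof
    assume "(SUP A\<in>sets M. ?D A) \<le> b"
    then show ?R
      by (smt (verit) bdd cSUP_upper)
  next
    assume R: ?R
    show "(SUP A\<in>sets M. ?D A) \<le> b"
    proof (rule cSUP_least)
      fix A assume A: "A \<in> sets M"
      have "measure \<mu> (space M - A) - measure \<mu>' (space M - A) \<le> b"
        using R A by auto
      moreover have "measure \<mu> (space M - A) = 1 - measure \<mu> A"
          "measure \<mu>' (space M - A) = 1 - measure \<mu>' A"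
        using A \<mu>.prob_compl[of A] \<mu>'.prob_compl[of A] by (simp_all add: sets sp)
      moreover have "measure \<mu> A - measure \<mu>' A \<le> b"
        using R A by blast
      ultimately show "?D A \<le> b" by linarith
    qed auto
  qed
  then show ?thesis
    unfolding tv_norm_diff_prob[OF assms] by simp
qed

section \<open>Integrals of one bounded function against two measures\<close>

text \<open>Boundedness makes \<open>f\<close> integrable for both finite measures, so both
  integrals agree with nonnegative integrals, which are monotone in the measure.\<close>

lemma integral_mono_measure_bounded:
  fixes f :: "'a \<Rightarrow> real"
  assumes "finite_measure M" "finite_measure N" and sets: "sets M = sets N"
    and le: "\<And>A. A \<in> sets M \<Longrightarrow> emeasure M A \<le> emeasure N A"
    and f: "f \<in> borel_measurable M" "\<And>x. x \<in> space M \<Longrightarrow> 0 \<le> f x \<and> f x \<le> b"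
  shows "integral\<^sup>L M f \<le> integral\<^sup>L N f"
proof -
  interpret M: finite_measure M by fact
  interpret N: finite_measure N by fact
  have sp: "space M = space N" using sets by (rule sets_eq_imp_space_eq)
  have fN: "f \<in> borel_measurable N" using f(1) sets by (simp cong: measurable_cong_sets)
  have "integrable N f"
    using f(2) sp by (intro N.integrable_const_bound[OF _ fN, of b] AE_I2) auto
  moreover have "integrable M f"
    using f by (intro M.integrable_const_bound[of _ b] AE_I2) auto
  moreover have "(\<integral>\<^sup>+x. ennreal (f x) \<partial>M) \<le> (\<integral>\<^sup>+x. ennreal (f x) \<partial>N)"
  proof (rule nn_integral_mono_measure[OF sets])
    \<comment> \<open>For equal sigma-algebras this order compares the measures on all sets; on
      nonmeasurable sets both vanish.\<close>
    show "M \<le> N"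
      unfolding le_measure[OF sets] le_fun_def
      using le sets by (metis emeasure_notin_sets order_refl)
  qed
  moreover have "AE x in M. 0 \<le> f x" "AE x in N. 0 \<le> f x"
    using f(2) sp by auto
  ultimately show ?thesis
    by (simp add: nn_integral_eq_integral integral_nonneg_AE)
qed

text \<open>A Hahn set gives domination only on its own subsets; restricting both measures to
  \<open>S\<close> turns this into domination everywhere.\<close>

lemma set_integral_mono_measure_bounded:
  fixes f :: "'a \<Rightarrow> real"
  assumes "finite_measure M" "finite_measure N" and sets: "sets M = sets N" and S: "S \<in> sets M"
    and le: "\<And>A. A \<in> sets M \<Longrightarrow> A \<subseteq> S \<Longrightarrow> emeasure M A \<le> emeasure N A"
    and f: "f \<in> borel_measurable M" "\<And>x. x \<in> space M \<Longrightarrow> 0 \<le> f x \<and> f x \<le> b"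
  shows "(LINT x:S|M. f x) \<le> (LINT x:S|N. f x)"
proof -
  have SN: "S \<in> sets N" using S sets by simp
  have SM': "S \<inter> space M \<in> sets M" "S \<inter> space N \<in> sets N" using S SN by auto
  have "integral\<^sup>L (restrict_space M S) f \<le> integral\<^sup>L (restrict_space N S) f"
  proof (rule integral_mono_measure_bounded)
    show "finite_measure (restrict_space M S)" "finite_measure (restrict_space N S)"
      using assms(1,2) S SN by (auto intro!: finite_measure_restrict_space)
    show "sets (restrict_space M S) = sets (restrict_space N S)"
      using sets by (simp add: sets_restrict_space)
    show "f \<in> borel_measurable (restrict_space M S)"
      using f(1) by (rule measurable_restrict_space1)
    show "0 \<le> f x \<and> f x \<le> b" if "x \<in> space (restrict_space M S)" for x
      using that f(2) by (simp add: space_restrict_space)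
    show "emeasure (restrict_space M S) A \<le> emeasure (restrict_space N S) A"
      if "A \<in> sets (restrict_space M S)" for A
      using that le S SN by (simp add: sets_restrict_space_iff emeasure_restrict_space)
  qed
  then show ?thesis
    using SM' by (simp add: integral_restrict_space set_lebesgue_integral_def)
qed

text \<open>Split along a Hahn set \<open>S\<close> of \<open>M - N\<close>. Off \<open>S\<close>
  the integral of \<open>h\<close> against \<open>M\<close> is at most that against
  \<open>N\<close>. On \<open>S\<close> the difference of the integrals is largest when
  \<open>h\<close> is the constant \<open>b\<close>, which gives
  \<open>b * (measure M S - measure N S)\<close>.\<close>

lemma integral_diff_le:
  fixes h :: "'a \<Rightarrow> real"
  assumes "finite_measure M" "finite_measure N" and sets: "sets N = sets M"
    and d: "\<And>A. A \<in> sets M \<Longrightarrow> measure M A - measure N A \<le> d"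
    and h: "h \<in> borel_measurable M" "\<And>x. x \<in> space M \<Longrightarrow> 0 \<le> h x \<and> h x \<le> b"
    and b: "0 \<le> b"
  shows "integral\<^sup>L M h - integral\<^sup>L N h \<le> b * d"
proof -
  interpret M: finite_measure M by fact
  interpret N: finite_measure N by fact
  have sp: "space N = space M" using sets by (rule sets_eq_imp_space_eq)
  have hN: "h \<in> borel_measurable N" using h(1) sets by (simp cong: measurable_cong_sets)
  obtain S where S: "S \<in> sets M"
    and pos: "\<forall>A\<in>sets M. A \<subseteq> S \<longrightarrow> emeasure N A \<le> emeasure M A"
    and neg: "\<forall>A\<in>sets M. A \<inter> S = {} \<longrightarrow> emeasure M A \<le> emeasure N A"
    using finite_unsigned_Hahn_decomposition[OF assms(1-3)] by (elim bexE conjE)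
  have SN: "S \<in> sets N" using S sets by simp
  have int: "integrable M h" "integrable N h"
    using h(2) sp
    by (intro M.integrable_const_bound[OF _ h(1), of b] N.integrable_const_bound[OF _ hN, of b]
        AE_I2; simp)+
  have set_int: "set_integrable M A h" "set_integrable N A h"
    "set_integrable M A (\<lambda>_. b)" "set_integrable N A (\<lambda>_. b)" if "A \<in> sets M" for A
    unfolding set_integrable_def
    by (rule integrable_mult_indicator; use that int sets in simp)+
  have "S \<union> (space M - S) = space M"
    using sets.sets_into_space[OF S] by auto
  then have split: "integral\<^sup>L M h = (LINT x:S|M. h x) + (LINT x:space M - S|M. h x)"
      "integral\<^sup>L N h = (LINT x:S|N. h x) + (LINT x:space M - S|N. h x)"
    using set_integral_Un[of S "space M - S" M h] set_integral_Un[of S "space M - S" N h]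
      set_integral_space[OF int(1)] set_integral_space[OF int(2)] S set_int sp
    by auto
  have "(LINT x:space M - S|M. h x) \<le> (LINT x:space M - S|N. h x)"
  proof (rule set_integral_mono_measure_bounded[OF assms(1,2) sets[symmetric]])
    show "emeasure M A \<le> emeasure N A" if "A \<in> sets M" "A \<subseteq> space M - S" for A
      using that neg by auto
  qed (use S h in auto)
  \<comment> \<open>On \<open>S\<close> the measure \<open>M\<close> dominates, so monotonicity is
    applied to the nonnegative function \<open>b - h\<close> to obtain an upper bound for the
    contribution of \<open>h\<close>.\<close>
  moreover have "(LINT x:S|N. b - h x) \<le> (LINT x:S|M. b - h x)"
    by (rule set_integral_mono_measure_bounded[OF assms(2,1) sets SN, where b = b])
      (use pos h hN sp sets in auto)
  moreover have "(LINT x:S|M. b - h x) = b * measure M S - (LINT x:S|M. h x)"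
      "(LINT x:S|N. b - h x) = b * measure N S - (LINT x:S|N. h x)"
    using S SN set_int[OF S]
    by (simp_all add: set_integral_const M.emeasure_eq_measure N.emeasure_eq_measure)
  moreover have "b * (measure M S - measure N S) \<le> b * d"
    using d[OF S] b by (rule mult_left_mono)
  ultimately show ?thesis
    unfolding split by (simp add: algebra_simps)
qed

section \<open>Products of a measure and a kernel\<close>

lemma
  assumes M: "prob_space M" and K: "K \<in> M \<rightarrow>\<^sub>M prob_algebra N"
  shows prob_space_kernel_prod: "prob_space (kernel_prod M N K)"
    and sets_kernel_prod: "sets (kernel_prod M N K) = sets (M \<Otimes>\<^sub>M N)"
  using theI'[OF kernel_prod_ex1[OF assms]] unfolding kernel_prod_def by blast+

text \<open>The definition fixes \<open>kernel_prod\<close> on rectangles only. The monadic bind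
  that places each \<open>K x\<close> on the fibre over \<open>x\<close> has the same values there,
  so uniqueness identifies the two, and for the bind the section formula holds on every measurable
  set.\<close>

lemma measure_kernel_prod:
  assumes M: "prob_space M" and K: "K \<in> M \<rightarrow>\<^sub>M prob_algebra N" and C: "C \<in> sets (M \<Otimes>\<^sub>M N)"
  shows "(\<lambda>x. measure (K x) (Pair x -` C)) \<in> borel_measurable M"
    and "measure (kernel_prod M N K) C = (LINT x|M. measure (K x) (Pair x -` C))"
proof -
  interpret M: prob_space M by fact
  have M': "M \<in> space (prob_algebra M)" using M by (simp add: space_prob_algebra)
  let ?f = "\<lambda>x. distr (K x) (M \<Otimes>\<^sub>M N) (Pair x)"
  have f: "?f \<in> M \<rightarrow>\<^sub>M prob_algebra (M \<Otimes>\<^sub>M N)"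
    by (rule measurable_distr_prob_space2[OF K]) simp
  have sections: "measure (?f x) D = measure (K x) (Pair x -` D)"
    if x: "x \<in> space M" and D: "D \<in> sets (M \<Otimes>\<^sub>M N)" for x D
  proof -
    have Kx: "sets (K x) = sets N"
      using measurable_space[OF K x] by (simp add: space_prob_algebra)
    have "Pair x \<in> K x \<rightarrow>\<^sub>M M \<Otimes>\<^sub>M N"
      using x Kx by (simp cong: measurable_cong_sets)
    moreover have "Pair x -` D \<subseteq> space (K x)"
      using sets.sets_into_space[OF D] sets_eq_imp_space_eq[OF Kx] by (auto simp: space_pair_measure)
    ultimately show ?thesis using D by (simp add: measure_distr Int_absorb2)
  qed
  have bind: "measure (M \<bind> ?f) D = (LINT x|M. measure (K x) (Pair x -` D))"
    if "D \<in> sets (M \<Otimes>\<^sub>M N)" for D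
    using that sections
    by (simp add: M.measure_bind[OF measurable_prob_algebraD[OF f]] cong: Bochner_Integration.integral_cong)
  have "measure (M \<bind> ?f) (A \<times> B) = (LINT x:A|M. measure (K x) B)"
    if AB: "A \<in> sets M" "B \<in> sets N" for A B
  proof -
    have "(LINT x|M. measure (K x) (Pair x -` (A \<times> B))) = (LINT x:A|M. measure (K x) B)"
      unfolding set_lebesgue_integral_def
      by (intro Bochner_Integration.integral_cong refl) (simp add: indicator_def)
    then show ?thesis using bind[of "A \<times> B"] AB by simp
  qed
  then have "kernel_prod M N K = M \<bind> ?f"
    unfolding kernel_prod_def using prob_space_bind'[OF M' f] sets_bind'[OF M' f]
    by (intro the1_equality[OF kernel_prod_ex1[OF M K]]) auto
  then show "measure (kernel_prod M N K) C = (LINT x|M. measure (K x) (Pair x -` C))"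
    using bind[OF C] by simp
  have "(\<lambda>x. measure (?f x) C) \<in> borel_measurable M"
    using measurable_compose[OF f measurable_measure_prob_algebra[OF C]] .
  then show "(\<lambda>x. measure (K x) (Pair x -` C)) \<in> borel_measurable M"
    using sections[OF _ C] by (simp cong: measurable_cong)
qed

text \<open>This is the induction step. The bound is kept in the form
  \<open>1 - (1 - e) * (1 - d)\<close> so that iterating it multiplies the complements. The
  condition \<open>e \<le> 1\<close> makes \<open>1 - e\<close> a valid nonnegative upper bound for
  \<open>h\<close>.\<close>

lemma kernel_prod_diff_le:
  assumes M: "prob_space M" "prob_space M'" and sets: "sets M' = sets M"
    and K: "K \<in> M \<rightarrow>\<^sub>M prob_algebra N" "K' \<in> M \<rightarrow>\<^sub>M prob_algebra N"
    and d: "\<And>A. A \<in> sets M \<Longrightarrow> measure M A - measure M' A \<le> d"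
    and e: "\<And>x B. x \<in> space M \<Longrightarrow> B \<in> sets N \<Longrightarrow> measure (K x) B - measure (K' x) B \<le> e"
    and e1: "e \<le> 1" and C: "C \<in> sets (M \<Otimes>\<^sub>M N)"
  shows "measure (kernel_prod M N K) C - measure (kernel_prod M' N K') C \<le> 1 - (1 - e) * (1 - d)"
proof -
  interpret M: prob_space M by fact
  interpret M': prob_space M' by fact
  have sp: "space M' = space M" using sets by (rule sets_eq_imp_space_eq)
  \<comment> \<open>Measurability depends only on the sigma-algebra, which \<open>M\<close> and
    \<open>M'\<close> share.\<close>
  have K'': "K' \<in> M' \<rightarrow>\<^sub>M prob_algebra N" and C': "C \<in> sets (M' \<Otimes>\<^sub>M N)"
    using K(2) C sets by (simp_all cong: measurable_cong_sets sets_pair_measure_cong)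
  define f where "f x = measure (K x) (Pair x -` C)" for x
  define g where "g x = measure (K' x) (Pair x -` C)" for x
  define h where "h x = max 0 (f x - e)" for x
  have f: "f \<in> borel_measurable M"
    and fC: "measure (kernel_prod M N K) C = integral\<^sup>L M f"
    using measure_kernel_prod[OF M(1) K(1) C] by (simp_all add: f_def[abs_def])
  have g: "g \<in> borel_measurable M'"
    and gC: "measure (kernel_prod M' N K') C = integral\<^sup>L M' g"
    using measure_kernel_prod[OF M(2) K'' C'] by (simp_all add: g_def[abs_def])
  have h: "h \<in> borel_measurable M" using f by (simp add: h_def[abs_def])
  then have h': "h \<in> borel_measurable M'" using sets by (simp cong: measurable_cong_sets)
  have f01: "0 \<le> f x" "f x \<le> 1" if "x \<in> space M" for x
    using measurable_space[OF K(1) that]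
    by (auto simp: f_def space_prob_algebra intro!: prob_space.prob_le_1)
  have g01: "0 \<le> g x" "g x \<le> 1" if "x \<in> space M" for x
    using measurable_space[OF K(2) that]
    by (auto simp: g_def space_prob_algebra intro!: prob_space.prob_le_1)
  have h01: "0 \<le> h x" "h x \<le> 1 - e" if "x \<in> space M" for x
    using f01[OF that] e1 by (auto simp: h_def)
  \<comment> \<open>Sections of \<open>C\<close> are measurable, so the setwise bound gives
    \<open>f x - e \<le> g x\<close>; the other branch of the maximum is
    \<open>0 \<le> g x\<close>.\<close>
  have hg: "h x \<le> g x" if x: "x \<in> space M" for x
    using e[OF x, of "Pair x -` C"] sets_Pair1[OF C] g01[OF x] by (simp add: h_def f_def g_def)
  have fi: "integrable M f"
    using f01 by (intro M.integrable_const_bound[OF _ f, of 1] AE_I2) auto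
  have gi: "integrable M' g"
    using g01 sp by (intro M'.integrable_const_bound[OF _ g, of 1] AE_I2) auto
  have hi: "integrable M h"
    using h01 by (intro M.integrable_const_bound[OF _ h, of "1 - e"] AE_I2) auto
  have hi': "integrable M' h"
    using h01 sp by (intro M'.integrable_const_bound[OF _ h', of "1 - e"] AE_I2) auto
  have "integral\<^sup>L M f \<le> (LINT x|M. h x + e)"
  proof (rule integral_mono[OF fi])
    show "integrable M (\<lambda>x. h x + e)" using hi by simp
  qed (auto simp: h_def)
  also have "\<dots> = integral\<^sup>L M h + e"
    using hi by (simp add: M.prob_space)
  finally have "integral\<^sup>L M f \<le> integral\<^sup>L M h + e" .
  moreover have "integral\<^sup>L M' h \<le> integral\<^sup>L M' g"
    using hg sp by (intro integral_mono hi' gi) simp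
  moreover have "integral\<^sup>L M h - integral\<^sup>L M' h \<le> (1 - e) * d"
    using h h01 d sets e1 M.finite_measure_axioms M'.finite_measure_axioms
    by (intro integral_diff_le) auto
  ultimately show ?thesis
    unfolding fC gC by (simp add: algebra_simps)
qed

section \<open>The product measures on \<open>Omega X n\<close>\<close>

lemma measurable_prod_measure_step:
  assumes "sets M = sets (Omega X n)"
  shows "(\<lambda>(\<omega>, x). fun_upd \<omega> (Suc n) x) \<in> M \<Otimes>\<^sub>M borel_of (X (Suc n)) \<rightarrow>\<^sub>M Omega X (Suc n)"
  using measurable_add_dim[of "Suc n" "{..n}" "\<lambda>k. borel_of (X k)"] assms
  by (simp add: Omega_def atMost_Suc cong: measurable_cong_sets sets_pair_measure_cong)

lemma measurable_prod_measure_init: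
  "(\<lambda>x. \<lambda>i\<in>{..0}. x) \<in> borel_of (X 0) \<rightarrow>\<^sub>M Omega X 0"
  unfolding Omega_def by (rule measurable_restrict) simp

lemma sets_prod_measure: "sets (prod_measure X P0 P n) = sets (Omega X n)"
  by (cases n) simp_all

text \<open>The description defining \<open>kernel_prod\<close> is known to denote the intended
  measure only when its first factor is a probability measure, so this property has to be carried
  along the recursion.\<close>

lemma prob_space_prod_measure:
  assumes "P0 \<in> space (prob_algebra (borel_of (X 0)))"
    and "\<And>k. k \<ge> 1 \<Longrightarrow> P k \<in> Omega X (k - 1) \<rightarrow>\<^sub>M prob_algebra (borel_of (X k))"
  shows "prob_space (prod_measure X P0 P n)"
proof (induction n)
  case 0
  have "(\<lambda>x. \<lambda>i\<in>{..0}. x) \<in> P0 \<rightarrow>\<^sub>M Omega X 0"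
    using assms(1) measurable_prod_measure_init[of X]
    by (simp add: space_prob_algebra cong: measurable_cong_sets)
  then show ?case
    using assms(1) by (auto simp: space_prob_algebra intro!: prob_space.prob_space_distr)
next
  case (Suc n)
  let ?M = "prod_measure X P0 P n"
  have K: "P (Suc n) \<in> ?M \<rightarrow>\<^sub>M prob_algebra (borel_of (X (Suc n)))"
    using assms(2)[of "Suc n"] by (simp add: sets_prod_measure cong: measurable_cong_sets)
  have "(\<lambda>(\<omega>, x). fun_upd \<omega> (Suc n) x) \<in>
      kernel_prod ?M (borel_of (X (Suc n))) (P (Suc n)) \<rightarrow>\<^sub>M Omega X (Suc n)"
    using measurable_prod_measure_step[OF sets_prod_measure]
    by (simp add: sets_kernel_prod[OF Suc K] cong: measurable_cong_sets)
  then show ?case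
    by (simp add: prob_space.prob_space_distr prob_space_kernel_prod[OF Suc K])
qed

text \<open>The condition \<open>c k \<le> 2\<close> keeps the factors \<open>1 - c k / 2\<close>
  nonnegative. Without it the claim fails: for equal laws and kernels, \<open>n = 1\<close> and
  \<open>c 0 = c 1 = 6\<close>, the left side is 0 and the right side is -6.\<close>

theorem theorem2:
  fixes X :: "nat \<Rightarrow> 'a topology"
    and P0 P0' :: "'a measure"
    and P P' :: "nat \<Rightarrow> (nat \<Rightarrow> 'a) \<Rightarrow> 'a measure"
    and c :: "nat \<Rightarrow> real"
    and n :: nat
  assumes "\<And>k. borel_space (X k)"
    and "P0 \<in> space (prob_algebra (borel_of (X 0)))"
    and "P0' \<in> space (prob_algebra (borel_of (X 0)))"
    and "\<And>k. k \<ge> 1 \<Longrightarrow> P k \<in> Omega X (k - 1) \<rightarrow>\<^sub>M prob_algebra (borel_of (X k))"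
    and "\<And>k. k \<ge> 1 \<Longrightarrow> P' k \<in> Omega X (k - 1) \<rightarrow>\<^sub>M prob_algebra (borel_of (X k))"
    and "tv_norm (borel_of (X 0)) (signed_diff P0 P0') \<le> c 0"
    and "\<And>k. k \<ge> 1 \<Longrightarrow>
      kernel_norm (Omega X (k - 1)) (borel_of (X k)) (\<lambda>\<omega>. signed_diff (P k \<omega>) (P' k \<omega>)) \<le> ereal (c k)"
    and "\<And>k. k \<le> n \<Longrightarrow> c k \<le> 2"
  shows "tv_norm (Omega X n) (signed_diff (prod_measure X P0 P n) (prod_measure X P0' P' n))
    \<le> 2 - 2 * (\<Prod>k=0..n. 1 - c k / 2)"
proof -
  have K: "P k \<in> Omega X (k - 1) \<rightarrow>\<^sub>M prob_algebra (borel_of (X k))"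
      "P' k \<in> Omega X (k - 1) \<rightarrow>\<^sub>M prob_algebra (borel_of (X k))" if "k \<ge> 1" for k
    using assms(4,5) that by auto
  note prob = prob_space_prod_measure[OF assms(2) assms(4)] prob_space_prod_measure[OF assms(3) assms(5)]
  have P0: "prob_space P0" "prob_space P0'"
    "sets P0 = sets (borel_of (X 0))" "sets P0' = sets (borel_of (X 0))"
    using assms(2,3) by (auto simp: space_prob_algebra)
  have kernel: "measure (P k \<omega>) B - measure (P' k \<omega>) B \<le> c k / 2"
    if k: "k \<ge> 1" and \<omega>: "\<omega> \<in> space (Omega X (k - 1))" and B: "B \<in> sets (borel_of (X k))" for k \<omega> B
  proof -
    have "ereal (tv_norm (borel_of (X k)) (signed_diff (P k \<omega>) (P' k \<omega>))) \<le> ereal (c k)"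
      using assms(7)[OF k] \<omega> by (simp add: kernel_norm_def SUP_le_iff)
    then show ?thesis
      using tv_norm_le_iff[of "P k \<omega>" "P' k \<omega>" "borel_of (X k)" "c k / 2"]
        measurable_space[OF K(1)[OF k] \<omega>] measurable_space[OF K(2)[OF k] \<omega>] B
      by (simp add: space_prob_algebra)
  qed
  \<comment> \<open>The induction runs on the setwise bound, half the norm bound. The event stays
    arbitrary because the step needs the hypothesis for all events, and \<open>m \<le> n\<close>
    keeps \<open>c m \<le> 2\<close> available.\<close>
  have "measure (prod_measure X P0 P m) A - measure (prod_measure X P0' P' m) A
      \<le> 1 - (\<Prod>k=0..m. 1 - c k / 2)" if "m \<le> n" "A \<in> sets (Omega X m)" for m A
    using that
  proof (induction m arbitrary: A)
    case 0
    let ?T = "\<lambda>x. \<lambda>i\<in>{..0::nat}. x"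
    have T: "?T \<in> P0 \<rightarrow>\<^sub>M Omega X 0" "?T \<in> P0' \<rightarrow>\<^sub>M Omega X 0"
      using measurable_prod_measure_init[of X] P0 by (simp_all cong: measurable_cong_sets)
    have "?T -` A \<inter> space P0 \<in> sets (borel_of (X 0))"
      using measurable_sets[OF T(1)] 0 P0 by simp
    moreover have "space P0' = space P0" using P0 by (metis sets_eq_imp_space_eq)
    ultimately show ?case
      using tv_norm_le_iff[OF P0, of "c 0 / 2"] assms(6) 0 T by (simp add: measure_distr)
  next
    case (Suc m)
    let ?M = "prod_measure X P0 P m" and ?M' = "prod_measure X P0' P' m"
    let ?N = "borel_of (X (Suc m))" and ?T = "\<lambda>(\<omega>, x). fun_upd \<omega> (Suc m) x"
    let ?R = "kernel_prod ?M ?N (P (Suc m))" and ?R' = "kernel_prod ?M' ?N (P' (Suc m))"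
    have KM: "P (Suc m) \<in> ?M \<rightarrow>\<^sub>M prob_algebra ?N" "P' (Suc m) \<in> ?M \<rightarrow>\<^sub>M prob_algebra ?N"
      "P' (Suc m) \<in> ?M' \<rightarrow>\<^sub>M prob_algebra ?N"
      using K[of "Suc m"] by (simp_all add: sets_prod_measure cong: measurable_cong_sets)
    have sR: "sets ?R = sets (?M \<Otimes>\<^sub>M ?N)" "sets ?R' = sets (?M \<Otimes>\<^sub>M ?N)"
      using sets_kernel_prod[OF prob(1) KM(1)] sets_kernel_prod[OF prob(2) KM(3)]
      by (simp_all add: sets_prod_measure cong: sets_pair_measure_cong)
    have T: "?T \<in> ?R \<rightarrow>\<^sub>M Omega X (Suc m)" "?T \<in> ?R' \<rightarrow>\<^sub>M Omega X (Suc m)"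
      using measurable_prod_measure_step[OF sets_prod_measure[of X P0 P m]] sR
      by (simp_all cong: measurable_cong_sets)
    \<comment> \<open>Each pushforward yields a preimage cut to its own space; equal spaces make
      these one event, at which the two kernel products can be compared.\<close>
    have "space ?R' = space ?R" using sR by (metis sets_eq_imp_space_eq)
    then have "measure (prod_measure X P0 P (Suc m)) A - measure (prod_measure X P0' P' (Suc m)) A
      = measure ?R (?T -` A \<inter> space ?R) - measure ?R' (?T -` A \<inter> space ?R)"
      using Suc.prems T by (simp add: measure_distr)
    \<comment> \<open>Left unsimplified to match the previous lemma with
      \<open>e = c (Suc m) / 2\<close> and \<open>d\<close> the bound from the induction hypothesis;
      the inner double complement is the product up to \<open>m\<close>.\<close>
    also have "\<dots> \<le> 1 - (1 - c (Suc m) / 2) * (1 - (1 - (\<Prod>k=0..m. 1 - c k / 2)))"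
    proof (rule kernel_prod_diff_le[OF prob _ KM(1,2)])
      show "sets ?M' = sets ?M" by (simp add: sets_prod_measure)
      show "measure ?M B - measure ?M' B \<le> 1 - (\<Prod>k=0..m. 1 - c k / 2)" if "B \<in> sets ?M" for B
        using Suc.IH[of B] Suc.prems that by (simp add: sets_prod_measure)
      show "measure (P (Suc m) x) B - measure (P' (Suc m) x) B \<le> c (Suc m) / 2"
        if "x \<in> space ?M" "B \<in> sets ?N" for x B
        using kernel[of "Suc m" x B] that sets_eq_imp_space_eq[OF sets_prod_measure[of X P0 P m]]
        by simp
      show "c (Suc m) / 2 \<le> 1" using assms(8)[of "Suc m"] Suc.prems by simp
      show "?T -` A \<inter> space ?R \<in> sets (?M \<Otimes>\<^sub>M ?N)"
        using measurable_sets[OF T(1)] Suc.prems sR by simp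
    qed
    finally show ?case by (simp add: mult.commute)
  qed
  then show ?thesis
    using tv_norm_le_iff[OF prob sets_prod_measure sets_prod_measure,
        where b = "1 - (\<Prod>k=0..n. 1 - c k / 2)"]
    by (simp add: right_diff_distrib)
qed

end
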